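(* For every integer $q\ge 0$, $r_{2^q}\le q+1$; equivalently, $r_n\le 1+\lceil\log_2 n\rceil$ for every positive integer $n$.
   Context: For a positive integer $n$, $G(n)$ is the bipartite graph with vertices $x_1,\ldots,x_n$ and $y_1,\ldots,y_n$ whose edges are the pairs $x_iy_j$ with $i\le j$. $r_n$ denotes the smallest $k$ such that the edges of $G(n)$ can be covered by complete bipartite subgraphs of $G(n)$ in such a way that no vertex belongs to more than $k$ of the subgraphs. Equivalently, $r_n$ is the smallest $k$ such that each vertex of $G(n)$ can be given a set of at most $k$ colors so that, for all $i,j$, $x_i$ and $y_j$ share a color if and only if $i\le j$ (the total number of colors used is unrestricted). *)

theory Defs
  imports Complex_Main
begin

text \<open>
  A finite simple graph is given by its vertex set \<open>V\<close> and its set \<open>E\<close> of edges, each edge being a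
  two-element set of vertices. A complete bipartite subgraph is represented by its two
  nonempty, disjoint parts \<open>(A, B)\<close>; it need not be an induced subgraph. The same subgraph may occur
  both as \<open>(A, B)\<close> and as \<open>(B, A)\<close>; listing it twice never lowers the number of members that a
  vertex belongs to.
\<close>

definition complete_bipartite_subgraph :: "'a set \<Rightarrow> 'a set set \<Rightarrow> 'a set \<times> 'a set \<Rightarrow> bool" where
  "complete_bipartite_subgraph V E H \<longleftrightarrow>
     (case H of (A, B) \<Rightarrow>
        A \<noteq> {} \<and> B \<noteq> {} \<and> A \<subseteq> V \<and> B \<subseteq> V \<and> A \<inter> B = {} \<and> (\<forall>a\<in>A. \<forall>b\<in>B. {a, b} \<in> E))"

definition subgraph_vertices :: "'a set \<times> 'a set \<Rightarrow> 'a set" where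
  "subgraph_vertices H = fst H \<union> snd H"

definition subgraph_edges :: "'a set \<times> 'a set \<Rightarrow> 'a set set" where
  "subgraph_edges H = {{a, b} | a b. a \<in> fst H \<and> b \<in> snd H}"

text \<open>For finite \<open>V\<close> every such family is finite, so \<open>card\<close> below counts as intended.\<close>

definition local_biclique_cover :: "'a set \<Rightarrow> 'a set set \<Rightarrow> nat \<Rightarrow> ('a set \<times> 'a set) set \<Rightarrow> bool" where
  "local_biclique_cover V E k F \<longleftrightarrow>
     (\<forall>H\<in>F. complete_bipartite_subgraph V E H) \<and>
     E \<subseteq> (\<Union>H\<in>F. subgraph_edges H) \<and>
     (\<forall>v\<in>V. card {H \<in> F. v \<in> subgraph_vertices H} \<le> k)"

text \<open>The vertex \<open>x\<^sub>i\<close> is \<open>Inl i\<close> and \<open>y\<^sub>j\<close> is \<open>Inr j\<close>, for \<open>i\<close> and \<open>j\<close> from \<open>1\<close> to \<open>n\<close>.\<close>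

definition G_verts :: "nat \<Rightarrow> (nat + nat) set" where
  "G_verts n = Inl ` {1..n} \<union> Inr ` {1..n}"

definition G_edges :: "nat \<Rightarrow> (nat + nat) set set" where
  "G_edges n = {{Inl i, Inr j} | i j. i \<in> {1..n} \<and> j \<in> {1..n} \<and> i \<le> j}"

definition r :: "nat \<Rightarrow> nat" where
  "r n = (LEAST k. \<exists>F. local_biclique_cover (G_verts n) (G_edges n) k F)"

text \<open>The minimum defining \<open>r\<close> is taken over a nonempty set: cover each edge by itself.\<close>

lemma finite_bicliques:
  assumes "finite V"
  shows "finite {H. complete_bipartite_subgraph V E H}"
proof (rule finite_subset)
  show "{H. complete_bipartite_subgraph V E H} \<subseteq> Pow V \<times> Pow V"
    by (auto simp: complete_bipartite_subgraph_def)
qed (use assms in simp)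

lemma local_biclique_cover_exists:
  "\<exists>k F. local_biclique_cover (G_verts n) (G_edges n) k F"
proof -
  let ?F = "{H. complete_bipartite_subgraph (G_verts n) (G_edges n) H}"
  have fin: "finite ?F"
    by (rule finite_bicliques) (simp add: G_verts_def)
  have "e \<in> (\<Union>H\<in>?F. subgraph_edges H)" if "e \<in> G_edges n" for e
  proof -
    from that obtain i j where ij: "i \<in> {1..n}" "j \<in> {1..n}" "e = {Inl i, Inr j}"
      by (auto simp: G_edges_def)
    have "({Inl i}, {Inr j}) \<in> ?F"
      using that ij by (auto simp: complete_bipartite_subgraph_def G_verts_def)
    moreover have "e \<in> subgraph_edges ({Inl i}, {Inr j})"
      using ij by (auto simp: subgraph_edges_def)
    ultimately show ?thesis by blast
  qed
  moreover have "card {H \<in> ?F. v \<in> subgraph_vertices H} \<le> card ?F" for v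
    by (rule card_mono[OF fin]) auto
  ultimately have "local_biclique_cover (G_verts n) (G_edges n) (card ?F) ?F"
    by (auto simp: local_biclique_cover_def)
  then show ?thesis by blast
qed

lemma r_attained: "\<exists>F. local_biclique_cover (G_verts n) (G_edges n) (r n) F"
  unfolding r_def using local_biclique_cover_exists by (rule LeastI_ex)

end

(* Colour the vertices with indices shifted to 0, ..., n - 1 < 2^q. For i < j let k be the highest
   binary digit in which i and j differ: there i has the digit 0 and j the digit 1, and the higher
   digits agree. So one biclique for each k < q and each choice of the higher digits covers all
   edges off the diagonal, each vertex lying in at most one biclique per k; the diagonal
   is covered edge by edge and accounts for the extra 1. *)

theory Submission
  imports Defs
begin

text \<open>Each colour yields one biclique, formed by the vertices that carry it, so a vertex lies
  in at most as many bicliques as it has colours. Colours with the same biclique merge in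
  \<open>F\<close>, which can only lower the count.\<close>

lemma r_le_of_coloring:
  fixes X Y :: "nat \<Rightarrow> 'c set"
  assumes fin: "\<And>i. i \<in> {1..n} \<Longrightarrow> finite (X i)" "\<And>i. i \<in> {1..n} \<Longrightarrow> finite (Y i)"
    and card: "\<And>i. i \<in> {1..n} \<Longrightarrow> card (X i) \<le> k" "\<And>i. i \<in> {1..n} \<Longrightarrow> card (Y i) \<le> k"
    and share: "\<And>i j. i \<in> {1..n} \<Longrightarrow> j \<in> {1..n} \<Longrightarrow> X i \<inter> Y j \<noteq> {} \<longleftrightarrow> i \<le> j"
  shows "r n \<le> k"
proof -
  define A where "A c = (Inl ` {i \<in> {1..n}. c \<in> X i} :: (nat + nat) set)" for c
  define B where "B c = (Inr ` {j \<in> {1..n}. c \<in> Y j} :: (nat + nat) set)" for c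
  \<comment> \<open>A colour seen on one side only would give an empty part, so it is dropped; it
    covers no edge.\<close>
  define F where "F = (\<lambda>c. (A c, B c)) ` {c. A c \<noteq> {} \<and> B c \<noteq> {}}"
  have "complete_bipartite_subgraph (G_verts n) (G_edges n) H" if "H \<in> F" for H
  proof -
    obtain c where c: "H = (A c, B c)" "A c \<noteq> {}" "B c \<noteq> {}"
      using \<open>H \<in> F\<close> by (auto simp: F_def)
    have "{a, b} \<in> G_edges n" if ab: "a \<in> A c" "b \<in> B c" for a b
    proof -
      obtain i j where ij: "a = Inl i" "b = Inr j" "i \<in> {1..n}" "j \<in> {1..n}"
          "c \<in> X i" "c \<in> Y j"
        using ab by (auto simp: A_def B_def)
      then have "i \<le> j"
        using share by blast
      with ij show ?thesis
        unfolding G_edges_def by blast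
    qed
    moreover have "A c \<subseteq> G_verts n" "B c \<subseteq> G_verts n" "A c \<inter> B c = {}"
      by (auto simp: A_def B_def G_verts_def)
    ultimately show ?thesis
      using c by (simp add: complete_bipartite_subgraph_def)
  qed
  moreover have "e \<in> (\<Union>H\<in>F. subgraph_edges H)" if "e \<in> G_edges n" for e
  proof -
    obtain i j where ij: "i \<in> {1..n}" "j \<in> {1..n}" "i \<le> j" "e = {Inl i, Inr j}"
      using \<open>e \<in> G_edges n\<close> by (auto simp: G_edges_def)
    then obtain c where "c \<in> X i" "c \<in> Y j"
      using share by blast
    then have "Inl i \<in> A c" "Inr j \<in> B c"
      using ij by (auto simp: A_def B_def)
    then have "(A c, B c) \<in> F" "e \<in> subgraph_edges (A c, B c)"
      using ij by (auto simp: F_def subgraph_edges_def)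
    then show ?thesis by blast
  qed
  moreover have "card {H \<in> F. v \<in> subgraph_vertices H} \<le> k" if v: "v \<in> G_verts n" for v
  proof -
    define C where "C = case_sum X Y v"
    have "{H \<in> F. v \<in> subgraph_vertices H} \<subseteq> (\<lambda>c. (A c, B c)) ` C"
      by (auto simp: C_def F_def A_def B_def subgraph_vertices_def)
    moreover have C: "finite C" "card C \<le> k"
      using v fin card by (auto simp: C_def G_verts_def)
    ultimately have "card {H \<in> F. v \<in> subgraph_vertices H} \<le> card C"
      by (intro surj_card_le)
    with C show ?thesis by simp
  qed
  ultimately have "local_biclique_cover (G_verts n) (G_edges n) k F"
    by (auto simp: local_biclique_cover_def)
  then show ?thesis
    unfolding r_def by (blast intro: Least_le)
qed

text \<open>Halving deletes the last digit. If the halves agree, only digit 0 differs; otherwise a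
  digit \<open>k\<close> found for the halves is digit \<open>Suc k\<close> of \<open>i\<close> and
  \<open>j\<close>.\<close>

lemma less_obtain_first_differing_digit:
  fixes i j :: nat
  assumes "i < j" "j < 2 ^ q"
  obtains k where "k < q" "even (i div 2 ^ k)" "j div 2 ^ k = Suc (i div 2 ^ k)"
proof -
  have "\<exists>k<q. even (i div 2 ^ k) \<and> j div 2 ^ k = Suc (i div 2 ^ k)"
    using assms
  proof (induction q arbitrary: i j)
    case (Suc q)
    show ?case
    proof (cases "i div 2 = j div 2")
      case True
      with \<open>i < j\<close> have "even i \<and> j = Suc i" by presburger
      then show ?thesis by (intro exI[of _ 0]) simp
    next
      case False
      with Suc.prems have "i div 2 < j div 2" "j div 2 < 2 ^ q" by auto
      from Suc.IH[OF this] obtain k where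
        "k < q" "even (i div 2 div 2 ^ k)" "j div 2 div 2 ^ k = Suc (i div 2 div 2 ^ k)"
        by blast
      then show ?thesis by (intro exI[of _ "Suc k"]) (simp add: div_mult2_eq)
    qed
  qed simp
  then show thesis using that by blast
qed

text \<open>Allowing every \<open>n\<close> up to \<open>2 ^ q\<close> gives both forms of the bound
  without an appeal to monotonicity of \<open>r\<close>.\<close>

lemma r_le_Suc_if_le_power2:
  assumes "n \<le> 2 ^ q"
  shows "r n \<le> Suc q"
proof -
  \<comment> \<open>The colour \<open>(k, m)\<close> with \<open>k < q\<close> names a biclique by
    its digit position and the common prefix with digit \<open>k\<close> set to 0. The tag
    \<open>q\<close> marks the colours of diagonal edges and clashes with no digit position.\<close>
  define X where "X i = insert (q, i)
    ((\<lambda>k. (k, (i - 1) div 2 ^ k)) ` {k. k < q \<and> even ((i - 1) div 2 ^ k)})" for i :: nat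
  \<comment> \<open>The oddness condition keeps the truncated subtraction honest.\<close>
  define Y where "Y j = insert (q, j)
    ((\<lambda>k. (k, (j - 1) div 2 ^ k - 1)) ` {k. k < q \<and> odd ((j - 1) div 2 ^ k)})" for j :: nat
  have card_le: "card (insert x (f ` {k. k < q \<and> P k})) \<le> Suc q"
    for x :: "nat \<times> nat" and f :: "nat \<Rightarrow> nat \<times> nat" and P
  proof -
    have "card (f ` {k. k < q \<and> P k}) \<le> card {k. k < q \<and> P k}"
      by (rule card_image_le) simp
    also have "\<dots> \<le> card {..<q}"
      by (rule card_mono) auto
    finally show ?thesis
      using card_insert_le_m1[of "Suc q"] by simp
  qed
  have share: "X i \<inter> Y j \<noteq> {} \<longleftrightarrow> i \<le> j" if ij: "i \<in> {1..n}" "j \<in> {1..n}" for i j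
  proof
    assume "X i \<inter> Y j \<noteq> {}"
    \<comment> \<open>The tags of a shared colour agree, so it is diagonal for both vertices or
      belongs to the same digit position for both.\<close>
    then consider "i = j"
      | k where "odd ((j - 1) div 2 ^ k)" "(i - 1) div 2 ^ k = (j - 1) div 2 ^ k - 1"
      unfolding X_def Y_def by blast
    then show "i \<le> j"
    proof cases
      case (2 k)
      then have "(i - 1) div 2 ^ k < (j - 1) div 2 ^ k"
        by (simp add: odd_pos)
      then have "\<not> j - 1 \<le> i - 1"
        using div_le_mono[of "j - 1" "i - 1" "2 ^ k"] by linarith
      then show ?thesis by simp
    qed simp
  next
    assume "i \<le> j"
    show "X i \<inter> Y j \<noteq> {}"
    proof (cases "i = j")
      case False
      \<comment> \<open>As \<open>i\<close> is at least 1, the shift by one keeps the inequality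
        strict.\<close>
      with \<open>i \<le> j\<close> ij assms have "i - 1 < j - 1" "j - 1 < 2 ^ q" by auto
      then obtain k where k: "k < q" "even ((i - 1) div 2 ^ k)"
          "(j - 1) div 2 ^ k = Suc ((i - 1) div 2 ^ k)"
        by (rule less_obtain_first_differing_digit)
      then have "(k, (i - 1) div 2 ^ k) \<in> X i" by (auto simp: X_def)
      \<comment> \<open>The prefix of \<open>j - 1\<close> is the successor of an even number, hence
        odd, and lowering it by one gives the prefix of \<open>i - 1\<close>.\<close>
      moreover from k have "(k, (i - 1) div 2 ^ k) \<in> Y j"
        unfolding Y_def by (intro insertI2 image_eqI[of _ _ k]) auto
      ultimately show ?thesis by blast
    qed (simp add: X_def Y_def)
  qed
  show ?thesis
  proof (rule r_le_of_coloring[of n X Y])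
    show "finite (X i)" "finite (Y i)" for i
      by (simp_all add: X_def Y_def)
    show "card (X i) \<le> Suc q" "card (Y i) \<le> Suc q" for i
      unfolding X_def Y_def by (rule card_le)+
  qed (rule share)
qed

theorem corollary3p3:
  shows "(\<forall>q::nat. r (2 ^ q) \<le> q + 1) \<and>
         (\<forall>n::nat. n \<ge> 1 \<longrightarrow> int (r n) \<le> 1 + \<lceil>log 2 (real n)\<rceil>)"
proof (intro conjI allI impI)
  show "r (2 ^ q) \<le> q + 1" for q
    using r_le_Suc_if_le_power2[of "2 ^ q" q] by simp
next
  fix n :: nat
  assume n: "n \<ge> 1"
  define q where "q = nat \<lceil>log 2 (real n)\<rceil>"
  \<comment> \<open>The ceiling is thus nonnegative, so \<open>nat\<close> does not truncate
    it.\<close>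
  have "0 \<le> log 2 (real n)"
    using n by simp
  then have q: "int q = \<lceil>log 2 (real n)\<rceil>"
    unfolding q_def by (intro nat_0_le) linarith
  then have "log 2 (real n) \<le> real q"
    by linarith
  then have "real n \<le> 2 powr real q"
    using n by (simp add: log_le_iff)
  then have "real n \<le> real (2 ^ q)"
    by (simp add: powr_realpow)
  then have "n \<le> 2 ^ q"
    by (simp only: of_nat_le_iff)
  then show "int (r n) \<le> 1 + \<lceil>log 2 (real n)\<rceil>"
    using r_le_Suc_if_le_power2[of n q] q by linarith
qed

end
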